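(* Let $n\ge2$, and let $K\subset\mathbb{R}^n$ be an $n$-simplex. Then $$d_{n,n-1}(K)=\frac{n+1}{2^n n!}=n^{-n}\left(\frac e2\right)^n e^{o(n)}\,,$$ where the $o(n)$ is for $n\to\infty$.
   Context: For a lattice $L\subset\mathbb{R}^n$ (of full rank), $D(L)$ is the absolute value of its determinant, and the density of the lattice of translates $\{K+x\mid x\in L\}$ of a convex body $K$ (compact, convex, with non-empty interior) is $V(K)/D(L)$. Such a lattice of translates is called $(n-1)$-impassable if each affine $(n-1)$-subspace of $\mathbb{R}^n$ meets some $K+x$, $x\in L$. $d_{n,n-1}(K)$ is the infimum of the densities of all $(n-1)$-impassable lattices of translates of $K$. *)

theory Defs
  imports "HOL-Analysis.Analysis" "HOL-Library.Landau_Symbols"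
begin

text \<open>The columns of \<open>A\<close> are the generators; they form a basis of the lattice when
  \<open>A\<close> is invertible.\<close>

definition lattice_of :: "real^'n^'n \<Rightarrow> (real^'n) set" where
  "lattice_of A = {A *v z | z. \<forall>i. z $ i \<in> \<int>}"

definition is_lattice :: "(real^'n) set \<Rightarrow> bool" where
  "is_lattice L \<longleftrightarrow> (\<exists>A. invertible A \<and> L = lattice_of A)"

definition lattice_det :: "(real^'n) set \<Rightarrow> real" where
  "lattice_det L = (THE d. \<exists>A. invertible A \<and> L = lattice_of A \<and> d = \<bar>det A\<bar>)"

lemma det_Ints:
  fixes M :: "real^'n^'n"
  assumes "\<And>i j. M $ i $ j \<in> \<int>"
  shows "det M \<in> \<int>"
  unfolding det_def using assms by (intro Ints_sum Ints_mult Ints_prod) auto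

lemma lattice_of_subset_factor:
  fixes A B :: "real^'n^'n"
  assumes "lattice_of B \<subseteq> lattice_of A"
  obtains M where "\<And>i j. M $ i $ j \<in> \<int>" "B = A ** M"
proof -
  have "\<exists>z. (\<forall>i. z $ i \<in> \<int>) \<and> column j B = A *v z" for j
  proof -
    have "column j B \<in> lattice_of B"
      unfolding lattice_of_def
      by (rule CollectI, rule exI[of _ "axis j 1"], rule conjI)
        (simp only: matrix_vector_mult_basis, simp add: axis_def)
    with assms have "column j B \<in> lattice_of A"
      by (rule subsetD)
    then show ?thesis
      unfolding lattice_of_def by blast
  qed
  then have "\<forall>j. \<exists>z. (\<forall>i. z $ i \<in> \<int>) \<and> column j B = A *v z"
    by blast
  from choice[OF this] obtain z where z: "\<And>j i. z j $ i \<in> \<int>" "\<And>j. column j B = A *v z j"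
    by blast
  define M :: "real^'n^'n" where "M = (\<chi> i j. z j $ i)"
  have "B = A ** M"
    using z(2) by (simp add: vec_eq_iff column_def matrix_vector_mult_def matrix_matrix_mult_def M_def)
  moreover have "M $ i $ j \<in> \<int>" for i j
    using z(1) by (simp add: M_def)
  ultimately show ?thesis using that by blast
qed

lemma lattice_det_lattice_of:
  fixes A :: "real^'n^'n"
  assumes "invertible A"
  shows "lattice_det (lattice_of A) = \<bar>det A\<bar>"
proof -
  have unique: "\<bar>det B\<bar> = \<bar>det A\<bar>" if B: "invertible B" "lattice_of A = lattice_of B" for B :: "real^'n^'n"
  proof -
    obtain M where M: "\<And>i j. M $ i $ j \<in> \<int>" "B = A ** M"
      using lattice_of_subset_factor[of B A] B by auto
    obtain N where N: "\<And>i j. N $ i $ j \<in> \<int>" "A = B ** N"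
      using lattice_of_subset_factor[of A B] B by auto
    have nz: "det A \<noteq> 0" "det B \<noteq> 0"
      using assms B by (auto simp: invertible_det_nz)
    have MN: "det B = det A * det M" "det A = det B * det N"
      by (subst M(2), rule det_mul) (subst N(2), rule det_mul)
    then have "det M \<noteq> 0" "det N \<noteq> 0" using nz by auto
    then have "1 \<le> \<bar>det M\<bar>" "1 \<le> \<bar>det N\<bar>"
      by (simp_all add: Ints_nonzero_abs_ge1 det_Ints M(1) N(1))
    then have "\<bar>det A\<bar> * 1 \<le> \<bar>det A\<bar> * \<bar>det M\<bar>" "\<bar>det B\<bar> * 1 \<le> \<bar>det B\<bar> * \<bar>det N\<bar>"
      by (intro mult_left_mono; simp)+
    moreover have "\<bar>det B\<bar> = \<bar>det A\<bar> * \<bar>det M\<bar>"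
      by (subst MN(1), rule abs_mult)
    moreover have "\<bar>det A\<bar> = \<bar>det B\<bar> * \<bar>det N\<bar>"
      by (subst MN(2), rule abs_mult)
    ultimately show ?thesis by linarith
  qed
  show ?thesis
    unfolding lattice_det_def
  proof (rule the_equality)
    show "\<exists>B. invertible B \<and> lattice_of A = lattice_of B \<and> \<bar>det A\<bar> = \<bar>det B\<bar>"
      using assms by (intro exI[of _ A] conjI refl)
  next
    fix d
    assume "\<exists>B. invertible B \<and> lattice_of A = lattice_of B \<and> d = \<bar>det B\<bar>"
    then show "d = \<bar>det A\<bar>"
      by (elim exE conjE) (simp only: unique)
  qed
qed

definition impassable :: "nat \<Rightarrow> (real^'n) set \<Rightarrow> (real^'n) set \<Rightarrow> bool" where
  "impassable k K L \<longleftrightarrow>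
     (\<forall>H. affine H \<and> aff_dim H = int k \<longrightarrow> (\<exists>x\<in>L. H \<inter> (\<lambda>y. y + x) ` K \<noteq> {}))"

definition translates_density :: "(real^'n) set \<Rightarrow> (real^'n) set \<Rightarrow> real" where
  "translates_density K L = measure lebesgue K / lattice_det L"

text \<open>\<open>min_density k K\<close> is $d_{n,k}(K)$, with \<open>n\<close> the cardinality of the index type. For a convex body \<open>K\<close> the set
  below is non-empty (a fine enough lattice even gives a covering of the space) and bounded below
  by \<open>0\<close>, so the real-valued \<open>Inf\<close> is the true infimum.\<close>

definition min_density :: "nat \<Rightarrow> (real^'n) set \<Rightarrow> real" where
  "min_density k K = Inf {translates_density K L | L. is_lattice L \<and> impassable k K L}"

end

theory Submission
  imports Defs "HOL-Real_Asymp.Real_Asymp"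
begin

text \<open>
  Write the simplex as the image of the standard simplex under \<open>t \<mapsto> p + P t\<close>. If the lattice with
  basis matrix \<open>A\<close> is impassable, then the simplex has width at least 1 in every non-zero direction of
  the dual lattice: otherwise a hyperplane slips between the translates. In the coordinates of
  the standard simplex the open unit ball of the width norm is the projection of an open unit cube of
  dimension \<open>n + 1\<close> along its diagonal, which has volume \<open>n + 1\<close>. The dual lattice
  translates of half this ball are disjoint, so \<open>\<bar>det P\<bar> / \<bar>det A\<bar> \<ge> (n + 1) / 2^n\<close>.

  The bound is attained by the lattice generated by \<open>2 (v - s)\<close> for the vertices \<open>v\<close> and the centroid
  \<open>s\<close> of the simplex. A linear form takes its mean over the vertices at \<open>s\<close>, and the mean lies within
  half the width of the maximum or of the minimum. Hence some lattice vector has a non-zero value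
  that is at most the width, and its multiples carry the simplex to every level of the form.
\<close>

section \<open>Volumes of linear images\<close>

lemma det_matrix_shear:
  fixes m n :: "'n::finite"
  assumes "m \<noteq> n"
  shows "det (matrix (\<lambda>v::real^'n. \<chi> i. if i = m then v $ m + v $ n else v $ i)) = 1"
proof -
  have "matrix (\<lambda>v::real^'n. \<chi> i. if i = m then v $ m + v $ n else v $ i)
      = (\<chi> i. if i = m then row m (mat 1) + 1 *s row n (mat 1) else row i (mat 1))"
    using assms by (auto simp: matrix_def vec_eq_iff row_def mat_def axis_def)
  then show ?thesis
    using det_row_operation[OF assms, of "mat 1 :: real^'n^'n" 1] by simp
qed

lemma abs_det_matrix_swap:
  fixes m n :: "'n::finite"
  shows "\<bar>det (matrix (\<lambda>v::real^'n. \<chi> i. v $ Transposition.transpose m n i))\<bar> = 1"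
proof -
  let ?p = "Transposition.transpose m n"
  have "matrix (\<lambda>v::real^'n. \<chi> i. v $ ?p i) = (\<chi> i. mat 1 $ ?p i)"
    by (auto simp: matrix_def vec_eq_iff mat_def axis_def)
  moreover have "?p permutes UNIV"
    by (simp add: permutes_swap_id)
  ultimately show ?thesis
    by (simp add: det_permute_rows sign_def abs_mult)
qed

text \<open>The library has these facts only for well-ordered index types.\<close>

lemma
  fixes f :: "real^'n \<Rightarrow> real^'n"
  assumes "linear f" "S \<in> lmeasurable"
  shows lmeasurable_linear_image: "f ` S \<in> lmeasurable"
    and measure_lebesgue_linear_image:
      "measure lebesgue (f ` S) = \<bar>det (matrix f)\<bar> * measure lebesgue S"
proof -
  have "\<forall>S\<in>lmeasurable. f ` S \<in> lmeasurable \<and>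
      measure lebesgue (f ` S) = \<bar>det (matrix f)\<bar> * measure lebesgue S"
    (is "?P f")
  \<comment> \<open>Every linear map is composed of maps that annihilate a coordinate, stretches,
    swaps and shears, and the claim passes to compositions because determinants multiply.\<close>
  proof (rule induct_linear_elementary[OF \<open>linear f\<close>])
    fix f g :: "real^'n \<Rightarrow> real^'n"
    assume lin: "linear f" "linear g" and "?P f" "?P g"
    then show "?P (f \<circ> g)"
      by (auto simp only: image_comp[symmetric] matrix_compose[OF lin(2,1)] det_mul abs_mult mult.assoc)
  next
    fix f :: "real^'n \<Rightarrow> real^'n" and i
    assume "linear f" and 0: "\<And>x. f x $ i = 0"
    have "negligible (f ` S)" for S
      by (rule negligible_subset[OF negligible_standard_hyperplane_cart[of i]]) (auto simp: 0)
    moreover have "det (matrix f) = 0"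
      by (rule det_zero_row(1)[of i]) (simp add: matrix_def row_def vec_eq_iff 0)
    ultimately show "?P f"
      by (simp add: negligible_iff_measure)
  next
    fix c :: "'n \<Rightarrow> real"
    have "det (matrix (\<lambda>x. \<chi> i. c i * x $ i)) = prod c UNIV"
      by (simp add: matrix_def det_diagonal axis_def)
    then show "?P (\<lambda>x. \<chi> i. c i * x $ i)"
      by (simp add: measurable_stretch measure_stretch)
  next
    fix m n :: 'n
    let ?p = "Transposition.transpose m n"
    let ?h = "\<lambda>x::real^'n. \<chi> i. x $ ?p i"
    have lin: "linear ?h"
      by (rule linearI) (simp_all add: vec_eq_iff)
    \<comment> \<open>By \<open>measure_linear_sufficient\<close> it is enough to know the volume
      factor on boxes.\<close>
    have "measure lebesgue (?h ` cbox a b) = 1 * measure lebesgue (cbox a b)" for a b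
    proof (cases "cbox a b = {}")
      case False
      have mem: "?h x \<in> cbox (?h a) (?h b)" if "x \<in> cbox a b" for x a b
        using that by (simp add: mem_box_cart)
      have invol: "?h (?h x) = x" for x
        by (simp add: vec_eq_iff)
      have img: "?h ` cbox a b = cbox (?h a) (?h b)"
      proof
        show "cbox (?h a) (?h b) \<subseteq> ?h ` cbox a b"
        proof
          fix y assume "y \<in> cbox (?h a) (?h b)"
          then have "?h y \<in> cbox a b"
            using mem[of y "?h a" "?h b"] by (simp only: invol)
          then show "y \<in> ?h ` cbox a b"
            using invol[of y] by (metis imageI)
        qed
      qed (use mem in blast)
      then have "cbox (?h a) (?h b) \<noteq> {}"
        using False by (metis image_is_empty)
      moreover have "(\<Prod>i\<in>UNIV. b $ ?p i - a $ ?p i) = (\<Prod>i\<in>UNIV. b $ i - a $ i)"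
        by (rule prod.reindex_bij_betw[of ?p UNIV UNIV "\<lambda>i. b $ i - a $ i"]) simp
      ultimately show ?thesis
        using False by (simp add: img content_cbox_cart)
    qed simp
    then have "?h ` S \<in> lmeasurable \<and> measure lebesgue (?h ` S) = measure lebesgue S"
      if "S \<in> lmeasurable" for S
      using measure_linear_sufficient[OF lin that, of 1] by simp
    then show "?P ?h"
      by (simp add: abs_det_matrix_swap)
  next
    fix m n :: 'n
    assume "m \<noteq> n"
    let ?h = "\<lambda>x::real^'n. \<chi> i. if i = m then x $ m + x $ n else x $ i"
    have lin: "linear ?h"
      by (rule linearI) (auto simp: vec_eq_iff algebra_simps)
    have "measure lebesgue (?h ` cbox a b) = 1 * measure lebesgue (cbox a b)" for a b
    proof (cases "cbox a b = {}")
      case False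
      \<comment> \<open>\<open>measure_shear_interval\<close> asks for a box whose lower end in
        coordinate \<open>n\<close> is non-negative; translation by \<open>?t\<close> makes that end
        0.\<close>
      let ?t = "(- a $ n) *\<^sub>R axis n (1::real)"
      have "?h ` (+) ?t ` cbox a b = (+) (?h ?t) ` ?h ` cbox a b"
        unfolding image_image by (rule image_cong) (simp_all add: linear_add[OF lin])
      then have "measure lebesgue (?h ` cbox a b) = measure lebesgue (?h ` (+) ?t ` cbox a b)"
        by (simp add: measure_translation)
      also have "\<dots> = measure lebesgue ((+) ?t ` cbox a b)"
        unfolding cbox_translation[symmetric]
      proof (rule measure_shear_interval[OF \<open>m \<noteq> n\<close>])
        show "cbox (?t + a) (?t + b) \<noteq> {}"
          using False by (simp only: cbox_translation image_is_empty not_False_eq_True)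
        show "0 \<le> (?t + a) $ n"
          by (simp add: axis_def)
      qed
      finally show ?thesis
        by (simp only: measure_translation mult_1)
    qed simp
    then have "?h ` S \<in> lmeasurable \<and> measure lebesgue (?h ` S) = measure lebesgue S"
      if "S \<in> lmeasurable" for S
      using measure_linear_sufficient[OF lin that, of 1] by simp
    then show "?P ?h"
      by (simp add: det_matrix_shear[OF \<open>m \<noteq> n\<close>])
  qed
  with assms show "f ` S \<in> lmeasurable"
    "measure lebesgue (f ` S) = \<bar>det (matrix f)\<bar> * measure lebesgue S"
    by auto
qed

section \<open>Volume bounds for sets without lattice differences\<close>

text \<open>Blichfeldt's argument: cut \<open>S\<close> along the integer translates of the
  half-open unit cube and move all pieces into that one cube. They stay disjoint there, so their
  total volume is at most 1.\<close>

lemma measure_le_1_if_no_integral_difference: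
  fixes S :: "(real^'n) set"
  assumes "S \<in> lmeasurable"
    and int_diff: "\<And>x y. x \<in> S \<Longrightarrow> y \<in> S \<Longrightarrow> \<forall>i. x $ i - y $ i \<in> \<int> \<Longrightarrow> x = y"
  shows "measure lebesgue S \<le> 1"
proof -
  define Z where "Z = {z::real^'n. \<forall>i. z $ i \<in> \<int>}"
  define D where "D = {x::real^'n. \<forall>i. 0 \<le> x $ i \<and> x $ i < 1}"
  define X where "X z = S \<inter> (+) z ` D" for z
  have S [measurable]: "S \<in> sets lebesgue"
    using assms(1) by (rule fmeasurableD)
  have "Z \<subseteq> (\<lambda>f. \<chi> i. of_int (f i)) ` (UNIV :: ('n \<Rightarrow> int) set)"
  proof
    fix z assume "z \<in> Z"
    then have "z = (\<chi> i. of_int \<lfloor>z $ i\<rfloor>)"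
      by (simp add: Z_def vec_eq_iff)
    then show "z \<in> (\<lambda>f. \<chi> i. of_int (f i)) ` (UNIV :: ('n \<Rightarrow> int) set)"
      by (metis rangeI)
  qed
  then have "countable Z"
    by (rule countable_subset) simp
  have "D = (\<Inter>i. {x. 0 \<le> x $ i} \<inter> {x. x $ i < 1})"
    by (auto simp: D_def)
  also have "\<dots> \<in> sets borel"
    by measurable
  finally have D: "D \<in> sets lebesgue"
    by (simp add: sets_completionI_sets)
  have X: "X z \<in> sets lebesgue" for z
    unfolding X_def using D by (intro sets.Int S lebesgue_sets_translation)
  \<comment> \<open>The cube is half-open, so the translate containing \<open>x\<close> is
    determined by the floors of its coordinates.\<close>
  have floor: "z = (\<chi> i. of_int \<lfloor>x $ i\<rfloor>)" if z: "z \<in> Z" and x: "x \<in> (+) z ` D" for x z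
  proof -
    have "z $ i = of_int \<lfloor>x $ i\<rfloor>" for i
    proof -
      have "z $ i \<in> \<int>"
        using z by (simp add: Z_def)
      then obtain k where k: "z $ i = of_int k"
        by (rule Ints_cases)
      obtain p where "x = z + p" "0 \<le> p $ i" "p $ i < 1"
        using x by (auto simp: D_def)
      with k have "\<lfloor>x $ i\<rfloor> = k"
        by (simp add: floor_eq_iff)
      with k show ?thesis
        by simp
    qed
    then show ?thesis
      by (subst vec_eq_iff) simp
  qed
  then have disj: "disjoint_family_on X Z"
    unfolding disjoint_family_on_def X_def by blast
  \<comment> \<open>A common point of two shifted pieces comes from two points of \<open>S\<close>
    with integral difference. These coincide by hypothesis, which forces
    \<open>z = w\<close>.\<close>
  have "disjoint_family_on (\<lambda>z. (+) (- z) ` X z) Z"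
    unfolding disjoint_family_on_def
  proof (intro ballI impI equals0I)
    fix z w p assume zw: "z \<in> Z" "w \<in> Z" "z \<noteq> w" "p \<in> (+) (- z) ` X z \<inter> (+) (- w) ` X w"
    then have "z + p \<in> S" "w + p \<in> S"
      by (auto simp: X_def)
    moreover have "\<forall>i. (z + p) $ i - (w + p) $ i \<in> \<int>"
      using zw by (simp add: Z_def)
    ultimately show False
      using int_diff zw by fastforce
  qed
  moreover have X': "(+) (- z) ` X z \<in> sets lebesgue" for z
    by (intro lebesgue_sets_translation X)
  moreover have "(\<Union>z\<in>Z. X z) = S"
  proof -
    have "x \<in> (+) (\<chi> i. of_int \<lfloor>x $ i\<rfloor>) ` D" for x :: "real^'n"
      by (rule image_eqI[of _ _ "\<chi> i. frac (x $ i)"])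
        (auto simp: D_def vec_eq_iff frac_def frac_lt_1, linarith)
    moreover have "(\<chi> i. of_int \<lfloor>x $ i\<rfloor>) \<in> Z" for x :: "real^'n"
      by (simp add: Z_def)
    ultimately show ?thesis
      unfolding X_def by blast
  qed
  moreover have "emeasure lebesgue ((+) (- z) ` X z) = emeasure lebesgue (X z)" for z
    using emeasure_lebesgue_affine[of 1 "- z" "X z"] by (simp add: ac_simps cong: image_cong_simp)
  ultimately have "emeasure lebesgue S = emeasure lebesgue (\<Union>z\<in>Z. (+) (- z) ` X z)"
    using emeasure_UN_countable[OF X \<open>countable Z\<close> disj]
      emeasure_UN_countable[OF X' \<open>countable Z\<close>] by simp
  also have "\<dots> \<le> emeasure lebesgue (cbox 0 1 :: (real^'n) set)"
    by (intro emeasure_mono) (auto simp: X_def D_def mem_box_cart less_imp_le)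
  also have "\<dots> = 1"
    by (auto simp: emeasure_lborel_cbox_eq Basis_vec_def inner_axis intro!: prod.neutral)
  finally show ?thesis
    using assms(1) by (simp add: measure_def enn2real_leI)
qed

text \<open>The inverse of \<open>C\<close> carries the lattice of \<open>C\<close> to the integer
  lattice and divides volumes by the absolute determinant of \<open>C\<close>.\<close>

lemma measure_le_abs_det_if_no_lattice_difference:
  fixes S :: "(real^'n) set" and C :: "real^'n^'n"
  assumes "S \<in> lmeasurable" "invertible C"
    and "\<And>x y. x \<in> S \<Longrightarrow> y \<in> S \<Longrightarrow> x - y \<in> lattice_of C \<Longrightarrow> x = y"
  shows "measure lebesgue S \<le> \<bar>det C\<bar>"
proof -
  obtain B where B: "B ** C = mat 1" "C ** B = mat 1"
    using assms(2) by (auto simp: invertible_def)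
  have CB: "C *v (B *v x) = x" for x
    by (simp add: matrix_vector_mul_assoc B)
  have "measure lebesgue ((*v) B ` S) \<le> 1"
  proof (rule measure_le_1_if_no_integral_difference)
    show "(*v) B ` S \<in> lmeasurable"
      by (intro lmeasurable_linear_image assms matrix_vector_mul_linear)
  next
    fix x y assume "x \<in> (*v) B ` S" "y \<in> (*v) B ` S" and int: "\<forall>i. x $ i - y $ i \<in> \<int>"
    then obtain x' y' where xy: "x' \<in> S" "y' \<in> S" "x = B *v x'" "y = B *v y'"
      by blast
    then have "x' - y' = C *v (x - y)"
      by (simp add: matrix_vector_mult_diff_distrib CB)
    then have "x' - y' \<in> lattice_of C"
      using int by (auto simp: lattice_of_def)
    then show "x = y"
      using assms(3) xy by blast
  qed
  then have "\<bar>det B\<bar> * measure lebesgue S \<le> 1"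
    by (simp add: measure_lebesgue_linear_image assms(1) matrix_of_matrix_vector_mul)
  moreover have "\<bar>det C\<bar> * \<bar>det B\<bar> = 1"
    using arg_cong[OF B(2), of det] by (simp add: det_mul flip: abs_mult)
  ultimately show ?thesis
    by (metis abs_ge_zero mult.assoc mult_1 mult_1_right mult_left_mono)
qed

section \<open>Asymptotics of the density\<close>

text \<open>Stirling's formula up to a logarithmic error. The induction step applies
  \<open>ln x \<le> x - 1\<close> to \<open>(n + 1) / n\<close> and to its reciprocal.\<close>

lemma ln_fact_bounds:
  fixes n :: nat
  assumes "n \<ge> 1"
  shows "n * ln n - n \<le> ln (fact n)" (is "?lower n")
    and "ln (fact n) \<le> n * ln n - n + 1 + ln n" (is "?upper n")
proof -
  have "?lower n \<and> ?upper n"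
    using assms
  proof (induction n rule: dec_induct)
    case (step n)
    let ?x = "real n"
    have x: "?x > 0"
      using step.hyps by simp
    have "ln ((?x + 1) / ?x) \<le> (?x + 1) / ?x - 1" "ln (?x / (?x + 1)) \<le> ?x / (?x + 1) - 1"
      using x by (intro ln_le_minus_one; simp)+
    then have "ln (?x + 1) - ln ?x \<le> 1 / ?x" "1 / (?x + 1) \<le> ln (?x + 1) - ln ?x"
      using x by (simp_all add: ln_div field_simps)
    then have "?x * (ln (?x + 1) - ln ?x) \<le> 1" "1 \<le> (?x + 1) * (ln (?x + 1) - ln ?x)"
      using x by (simp_all add: field_simps)
    moreover have "ln (fact (Suc n)) = ln (?x + 1) + ln (fact n)"
      using x by (simp add: ln_mult add.commute)
    ultimately show ?case
      using step.IH by (simp add: algebra_simps)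
  qed simp
  then show "?lower n" "?upper n"
    by blast+
qed

lemma density_asymptotics:
  "\<exists>r \<in> o(\<lambda>n. real n). \<forall>n\<ge>2.
     (real n + 1) / (2 ^ n * fact n) = real n powr (- real n) * (exp 1 / 2) ^ n * exp (r n)"
proof (intro bexI allI impI)
  \<comment> \<open>The equation forces this choice: \<open>r n\<close> is the logarithm of
    \<open>(n + 1) * n ^ n / (exp n * n!)\<close>.\<close>
  define r where "r n = ln (real n + 1) + n * ln (real n) - n - ln (fact n)" for n :: nat
  have "\<bar>r n\<bar> \<le> \<bar>ln (real n + 1) + 1\<bar>" if "n \<ge> 1" for n
  proof -
    have "ln (real n) \<le> ln (real n + 1)" "0 \<le> ln (real n)"
      using that by simp_all
    then show ?thesis
      using ln_fact_bounds[OF that] by (simp add: r_def)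
  qed
  then have "r \<in> O(\<lambda>n. ln (real n + 1) + 1)"
    by (intro bigoI[of _ 1] eventually_sequentiallyI[of 1]) simp
  moreover have "(\<lambda>n. ln (real n + 1) + 1) \<in> o(\<lambda>n. real n)"
    by real_asymp
  ultimately show "r \<in> o(\<lambda>n. real n)"
    by (rule landau_o.big_small_trans)
  show "(real n + 1) / (2 ^ n * fact n)
      = real n powr (- real n) * (exp 1 / 2) ^ n * exp (r n)" if "n \<ge> 2" for n
    using that
    by (simp add: r_def exp_add exp_diff exp_minus powr_def power_divide field_simps
        flip: exp_of_nat_mult)
qed

section \<open>Simplices as affine images of the standard simplex\<close>

text \<open>One vertex \<open>p\<close> becomes the origin, and the columns of \<open>P\<close> are
  the edge vectors from \<open>p\<close>; affine independence of the vertices makes these linearly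
  independent.\<close>

lemma aff_independent_eq_image_insert_0_Basis:
  fixes X :: "(real^'n) set"
  assumes "\<not> affine_dependent X" "card X = CARD('n) + 1"
  obtains p and P :: "real^'n^'n" where "invertible P" "X = (\<lambda>x. p + P *v x) ` insert 0 Basis"
proof -
  have "finite X" "X \<noteq> {}"
    using assms by (auto intro: aff_independent_finite)
  then obtain p where p: "p \<in> X"
    by blast
  then have "card (UNIV :: 'n set) = card (X - {p})"
    using assms(2) \<open>finite X\<close> by simp
  then obtain f :: "'n \<Rightarrow> real^'n" where f: "bij_betw f UNIV (X - {p})"
    using \<open>finite X\<close> by (metis finite finite_Diff finite_same_card_bij)
  define P :: "real^'n^'n" where "P = (\<chi> i j. (f j - p) $ i)"
  have col: "column j P = f j - p" for j
    by (simp add: P_def column_def vec_eq_iff)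
  have P_Basis: "P *v axis j 1 = f j - p" for j
    by (simp add: matrix_vector_mult_basis col)
  have "inj (\<lambda>j. f j - p)"
    using f by (auto simp: bij_betw_def inj_on_def)
  have indep: "independent (range (\<lambda>j. f j - p))"
  proof -
    have "range (\<lambda>j. f j - p) = (\<lambda>x. - p + x) ` (X - {p})"
      using bij_betw_imp_surj_on[OF f, symmetric] by (simp add: image_image)
    then show ?thesis
      using assms(1) affine_dependent_iff_dependent2[OF p] by simp
  qed
  have "c i = 0" if "(\<Sum>j\<in>UNIV. c j *s column j P) = 0" for c i
  proof -
    \<comment> \<open>\<open>independentD\<close> wants coefficients indexed by vectors, so
      \<open>c\<close> is transported along the inverse of the injective indexing.\<close>
    let ?u = "\<lambda>v. c (inv (\<lambda>j. f j - p) v)"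
    have inv: "?u (f j - p) = c j" for j
      using inv_f_f[OF \<open>inj (\<lambda>j. f j - p)\<close>] by simp
    have "(\<Sum>v\<in>range (\<lambda>j. f j - p). ?u v *\<^sub>R v) = (\<Sum>j\<in>UNIV. c j *s column j P)"
      using \<open>inj (\<lambda>j. f j - p)\<close> by (simp add: sum.reindex col scalar_mult_eq_scaleR inv)
    then have "?u (f i - p) = 0"
      using that by (intro independentD[OF indep finite_imageI subset_refl]) auto
    then show ?thesis
      by (simp only: inv)
  qed
  then have "invertible P"
    by (simp add: invertible_left_inverse matrix_left_invertible_independent_columns)
  moreover have "X = (\<lambda>x. p + P *v x) ` insert 0 Basis"
  proof -
    have "(\<lambda>x. p + P *v x) ` Basis = range f"
      by (auto simp: Basis_vec_def P_Basis image_iff)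
    then show ?thesis
      using bij_betw_imp_surj_on[OF f] p by auto
  qed
  ultimately show thesis
    using that by blast
qed

lemma simplex_eq_affine_image_std_simplex:
  fixes K :: "(real^'n) set"
  assumes "int CARD('n) simplex K"
  obtains p and P :: "real^'n^'n" where "invertible P" "K = (\<lambda>x. p + P *v x) ` (convex hull (insert 0 Basis))"
proof -
  obtain X where X: "\<not> affine_dependent X" "card X = CARD('n) + 1" "K = convex hull X"
    using assms by (auto simp: simplex_def)
  then obtain p and P :: "real^'n^'n" where P: "invertible P" "X = (\<lambda>x. p + P *v x) ` insert 0 Basis"
    using aff_independent_eq_image_insert_0_Basis by blast
  have "convex hull ((\<lambda>x. p + P *v x) ` insert 0 Basis) = (+) p ` (*v) P ` (convex hull insert 0 Basis)"
    using convex_hull_translation[of p "(*v) P ` insert 0 Basis"]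
    by (simp only: image_image convex_hull_linear_image[OF matrix_vector_mul_linear])
  then show thesis
    by (intro that[OF P(1)]) (simp only: X(3) P(2) image_image)
qed

lemma measure_affine_image_std_simplex:
  fixes P :: "real^'n^'n"
  shows "measure lebesgue ((\<lambda>x. p + P *v x) ` (convex hull (insert 0 Basis))) = \<bar>det P\<bar> / fact CARD('n)"
proof -
  let ?T = "convex hull (insert 0 Basis) :: (real^'n) set"
  have T: "compact ?T"
    by (intro finite_imp_compact_convex_hull) simp
  have "measure lebesgue ((\<lambda>x. p + P *v x) ` ?T) = measure lebesgue ((*v) P ` ?T)"
    using measure_translation[of p "(*v) P ` ?T"] by (simp add: image_image)
  also have "\<dots> = \<bar>det P\<bar> * measure lebesgue ?T"
    using T by (simp add: measure_lebesgue_linear_image lmeasurable_compact matrix_of_matrix_vector_mul)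
  also have "measure lebesgue ?T = 1 / fact CARD('n)"
    using T by (simp add: content_std_simplex borel_compact)
  finally show ?thesis
    by simp
qed

section \<open>Width of the simplex against the dual lattice\<close>

text \<open>The set is a half-unit cube of dimension \<open>n + 1\<close> projected along its diagonal, up to a null set. It
  is cut into \<open>n + 1\<close> parallelepipeds according to which coordinate of the cube is smallest; \<open>None\<close>
  stands for the extra coordinate, normalised to be \<open>0\<close> after the projection.\<close>

lemma projected_cube_measure:
  obtains S :: "(real^'n) set"
  where "S \<in> lmeasurable" "measure lebesgue S = (real CARD('n) + 1) / 2 ^ CARD('n)"
    "\<And>x y. x \<in> S \<Longrightarrow> y \<in> S \<Longrightarrow> \<exists>c. \<bar>c\<bar> < 1/2 \<and> (\<forall>i. \<bar>x $ i - y $ i - c\<bar> < 1/2)"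
proof
  define Q where "Q = (box 0 (\<chi> i. 1/2) :: (real^'n) set)"
  \<comment> \<open>A point of \<open>Q\<close> lists the excesses of the other cube coordinates
    over the smallest one, coordinate \<open>k\<close>. For \<open>k = Some m\<close> its entry
    \<open>m\<close> holds the excess of the extra coordinate, and \<open>M k\<close> subtracts it
    everywhere to normalise that coordinate to 0.\<close>
  define M :: "'n option \<Rightarrow> real^'n \<Rightarrow> real^'n" where
    "M k x = (case k of None \<Rightarrow> x | Some m \<Rightarrow> \<chi> i. (if i = m then 0 else x $ i) - x $ m)" for k x
  have Q: "x \<in> Q \<longleftrightarrow> (\<forall>i. 0 < x $ i \<and> x $ i < 1/2)" for x
    by (simp add: Q_def mem_box_cart)
  have lin: "linear (M k)" for k
    by (rule linearI) (auto simp: M_def vec_eq_iff algebra_simps split: option.splits)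
  have det_M: "\<bar>det (matrix (M k))\<bar> = 1" for k
  proof (cases k)
    case None
    then have "M k = (\<lambda>x. x)"
      by (simp add: M_def fun_eq_iff)
    then show ?thesis
      by (simp add: matrix_id_mat_1[unfolded id_def])
  next
    case (Some m)
    \<comment> \<open>This is the identity matrix with column \<open>m\<close> replaced by entries
      -1; by Cramer's rule its determinant is -1.\<close>
    then have "matrix (M k) = (\<chi> i j. if j = m then (mat 1 *v (\<chi> i. - 1)) $ i else mat 1 $ i $ j)"
      unfolding matrix_vector_mul_lid
      by (auto simp: M_def matrix_def vec_eq_iff mat_def axis_def)
    then show ?thesis
      using cramer_lemma[of m "mat 1 :: real^'n^'n" "\<chi> i. - 1"] by simp
  qed
  have "measure lebesgue Q = measure lborel (cbox 0 (\<chi> i. 1/2) :: (real^'n) set)"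
    unfolding Q_def by (simp add: measure_lborel_box_eq measure_lborel_cbox_eq)
  also have "\<dots> = 1 / 2 ^ CARD('n)"
    by (subst content_cbox_cart) (simp_all add: interval_ne_empty_cart power_divide)
  finally have Q_meas: "Q \<in> lmeasurable" "measure lebesgue Q = 1 / 2 ^ CARD('n)"
    by (simp_all add: Q_def)
  have piece: "M k ` Q \<in> lmeasurable" "measure lebesgue (M k ` Q) = 1 / 2 ^ CARD('n)" for k
    using lin Q_meas by (simp_all add: lmeasurable_linear_image measure_lebesgue_linear_image det_M)
  define coord where "coord k x = (case k of None \<Rightarrow> 0 | Some m \<Rightarrow> x $ m)" for k and x :: "real^'n"
  \<comment> \<open>On the piece of index \<open>k\<close>, coordinate \<open>k\<close> is the
    strict minimum, so distinct pieces are disjoint.\<close>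
  have smallest: "coord k x < coord l x" if "x \<in> M k ` Q" "l \<noteq> k" for k l x
    using that by (auto simp: coord_def M_def Q split: option.splits if_splits)
  have spread: "coord k x \<le> coord l x \<and> coord l x < coord k x + 1/2" if "x \<in> M k ` Q" for k l x
    using that by (auto simp: coord_def M_def Q less_imp_le split: option.splits)
  let ?S = "\<Union>k. M k ` Q"
  show "?S \<in> lmeasurable"
    by (intro fmeasurable.finite_UN piece) simp
  have "pairwise (\<lambda>k l. disjnt (M k ` Q) (M l ` Q)) UNIV"
    unfolding pairwise_def disjnt_iff using smallest by (metis less_asym)
  then have "measure lebesgue ?S = (\<Sum>k\<in>UNIV. measure lebesgue (M k ` Q))"
    by (intro measure_UNION' piece) simp_all
  then show "measure lebesgue ?S = (real CARD('n) + 1) / 2 ^ CARD('n)"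
    by (simp add: piece UNIV_option_conv card_image)
  fix x y assume "x \<in> ?S" "y \<in> ?S"
  then obtain k l where kl: "x \<in> M k ` Q" "y \<in> M l ` Q"
    by blast
  \<comment> \<open>\<open>?c\<close> is the difference of the smallest coordinates of
    \<open>x\<close> and \<open>y\<close>. All coordinates exceed their minimum by less than 1/2, so
    removing \<open>?c\<close> leaves differences below 1/2; the extra coordinate yields the bound
    on \<open>?c\<close> itself.\<close>
  let ?c = "coord k x - coord l y"
  have close: "\<bar>coord h x - coord h y - ?c\<bar> < 1/2" for h
    using spread[OF kl(1), of h] spread[OF kl(2), of h] by (auto simp: abs_if)
  have "\<bar>?c\<bar> < 1/2"
    using close[of None] by (simp add: coord_def[of None] abs_minus_commute)
  moreover have "\<forall>i. \<bar>x $ i - y $ i - ?c\<bar> < 1/2"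
    using close[of "Some i" for i] by (simp add: coord_def[of "Some i" for i])
  ultimately show "\<exists>c. \<bar>c\<bar> < 1/2 \<and> (\<forall>i. \<bar>x $ i - y $ i - c\<bar> < 1/2)"
    by blast
qed

text \<open>Otherwise the form \<open>a = z v* B\<close> takes on the simplex, relative to
  \<open>p\<close>, only values in the open unit interval centred at \<open>c\<close>; the bound on
  \<open>c\<close> accounts for the vertex 0. The form is integral on the lattice, so the translates
  miss a level.\<close>

lemma impassable_simplex_dual_not_narrow:
  fixes A B P :: "real^'n^'n"
  assumes BA: "B ** A = mat 1"
    and imp: "impassable (CARD('n) - 1) ((\<lambda>x. p + P *v x) ` (convex hull (insert 0 Basis))) (lattice_of A)"
    and z: "\<And>i. z $ i \<in> \<int>" "z \<noteq> 0" and c: "\<bar>c\<bar> < 1/2"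
  shows "\<exists>j. \<bar>(z v* (B ** P)) $ j - c\<bar> \<ge> 1/2"
proof (rule ccontr)
  assume "\<not> ?thesis"
  then have narrow: "\<bar>(z v* (B ** P)) $ j - c\<bar> < 1/2" for j
    by (simp add: not_le)
  define a where "a = z v* B"
  have a_A: "a \<bullet> (A *v w) = z \<bullet> w" for w
    by (simp add: a_def dot_lmul_matrix matrix_vector_mul_assoc BA)
  then have "a \<noteq> 0"
    using z(2) by (metis inner_eq_zero_iff inner_zero_left)
  \<comment> \<open>The level is an endpoint of the open unit interval, hence outside all its
    integer translates.\<close>
  let ?H = "{y. a \<bullet> y = a \<bullet> p + c + 1/2}"
  have "aff_dim ?H = int (CARD('n) - 1)"
    using aff_dim_hyperplane[OF \<open>a \<noteq> 0\<close>] by (simp add: of_nat_diff Suc_leI)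
  with imp have "\<exists>x\<in>lattice_of A. ?H \<inter> (\<lambda>y. y + x) ` ((\<lambda>x. p + P *v x) ` (convex hull (insert 0 Basis))) \<noteq> {}"
    unfolding impassable_def by (simp only: affine_hyperplane)
  then obtain x y where x: "x \<in> lattice_of A"
    and y: "y \<in> (\<lambda>x. p + P *v x) ` (convex hull (insert 0 Basis))" and "y + x \<in> ?H"
    by auto
  from x obtain w where w: "x = A *v w" "\<And>i. w $ i \<in> \<int>"
    by (auto simp: lattice_of_def)
  have "z \<bullet> w \<in> \<int>"
    unfolding inner_vec_def using z(1) w(2) by (auto intro!: Ints_sum Ints_mult)
  then obtain k where k: "z \<bullet> w = of_int k"
    by (rule Ints_cases)
  have "convex hull (insert 0 Basis) \<subseteq> {t. (a v* P) \<bullet> t > c - 1/2} \<inter> {t. (a v* P) \<bullet> t < c + 1/2}"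
  proof (rule hull_minimal)
    have Basis: "\<bar>(a v* P) \<bullet> b - c\<bar> < 1/2" if "b \<in> Basis" for b
      using that narrow
      by (auto simp: a_def Basis_vec_def inner_axis vector_matrix_mul_assoc)
    have "(a v* P) \<bullet> b > c - 1/2 \<and> (a v* P) \<bullet> b < c + 1/2" if "b \<in> insert 0 Basis" for b
    proof (cases "b = 0")
      case True
      with c show ?thesis by simp linarith
    next
      case False
      with that have "\<bar>(a v* P) \<bullet> b - c\<bar> < 1/2"
        by (intro Basis) blast
      then show ?thesis by linarith
    qed
    then show "insert 0 Basis \<subseteq> {t. (a v* P) \<bullet> t > c - 1/2} \<inter> {t. (a v* P) \<bullet> t < c + 1/2}"
      by blast
    show "convex ({t. (a v* P) \<bullet> t > c - 1/2} \<inter> {t. (a v* P) \<bullet> t < c + 1/2})"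
      by (intro convex_Int convex_halfspace_lt convex_halfspace_gt)
  qed
  then have "c - 1/2 < a \<bullet> y - a \<bullet> p \<and> a \<bullet> y - a \<bullet> p < c + 1/2"
    using y by (auto simp: inner_add_right dot_lmul_matrix)
  moreover have "a \<bullet> y + of_int k = a \<bullet> p + c + 1/2"
    using \<open>y + x \<in> ?H\<close> by (simp add: inner_add_right w(1) a_A k)
  ultimately have "0 < k" "k < 1"
    by linarith+
  then show False
    by simp
qed

section \<open>The extremal lattice\<close>

lemma lattice_of_closed:
  shows lattice_of_0: "0 \<in> lattice_of A"
    and lattice_of_add: "x \<in> lattice_of A \<Longrightarrow> y \<in> lattice_of A \<Longrightarrow> x + y \<in> lattice_of A"
    and lattice_of_scale: "x \<in> lattice_of A \<Longrightarrow> of_int k *\<^sub>R x \<in> lattice_of A"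
    and lattice_of_column: "column j A \<in> lattice_of A"
proof -
  show "0 \<in> lattice_of A"
    unfolding lattice_of_def by (auto intro!: exI[of _ 0])
  show "column j A \<in> lattice_of A"
    unfolding lattice_of_def
    by (intro CollectI exI[of _ "axis j 1"] conjI) (simp_all only: matrix_vector_mult_basis, simp add: axis_def)
  show "x + y \<in> lattice_of A" if "x \<in> lattice_of A" "y \<in> lattice_of A"
  proof -
    from that obtain v w where "x = A *v v" "y = A *v w" "\<forall>i. v $ i \<in> \<int>" "\<forall>i. w $ i \<in> \<int>"
      by (auto simp: lattice_of_def)
    then show ?thesis
      unfolding lattice_of_def
      by (intro CollectI exI[of _ "v + w"]) (simp add: matrix_vector_right_distrib)
  qed
  show "of_int k *\<^sub>R x \<in> lattice_of A" if "x \<in> lattice_of A"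
  proof -
    from that obtain v where "x = A *v v" "\<forall>i. v $ i \<in> \<int>"
      by (auto simp: lattice_of_def)
    then show ?thesis
      unfolding lattice_of_def
      by (intro CollectI exI[of _ "of_int k *\<^sub>R v"]) (simp add: matrix_vector_mult_scaleR)
  qed
qed

lemma lattice_of_diff:
  "x \<in> lattice_of A \<Longrightarrow> y \<in> lattice_of A \<Longrightarrow> x - y \<in> lattice_of A"
  using lattice_of_add[of x A "- y"] lattice_of_scale[of y A "-1"] by simp

lemma lattice_of_sum:
  "(\<And>i. i \<in> I \<Longrightarrow> f i \<in> lattice_of A) \<Longrightarrow> sum f I \<in> lattice_of A"
  by (induction I rule: infinite_finite_induct) (auto intro: lattice_of_0 lattice_of_add)

text \<open>The lattice is generated by the vectors \<open>2 (v - s)\<close>, where \<open>v\<close> runs over the vertices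
  of the simplex with centroid \<open>s\<close>; one column of \<open>2P\<close> is replaced by \<open>2s\<close> to get a basis.\<close>

lemma lattice_around_centroid:
  fixes P :: "real^'n^'n"
  assumes "invertible P"
  defines "s \<equiv> \<chi> i. 1 / (real CARD('n) + 1)"
  obtains B where "invertible B" "\<bar>det B\<bar> = 2 ^ CARD('n) * \<bar>det P\<bar> / (real CARD('n) + 1)"
    "\<And>e. e \<in> insert 0 Basis \<Longrightarrow> 2 *\<^sub>R (P *v (e - s)) \<in> lattice_of B"
proof -
  define A where "A = (\<chi> i. 2 *s P $ i)"
  have A: "A *v x = 2 *\<^sub>R (P *v x)" for x
    by (simp add: A_def matrix_vector_mult_def vec_eq_iff sum_distrib_left mult.assoc)
  have det_A: "det A = 2 ^ CARD('n) * det P"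
    using det_rows_mul[of "\<lambda>_. 2" "\<lambda>i. P $ i"] by (simp add: A_def)
  \<comment> \<open>Any column can be replaced, since all entries of \<open>s\<close> are
    equal.\<close>
  define k :: 'n where "k = undefined"
  define B where "B = (\<chi> i j. if j = k then (A *v s) $ i else A $ i $ j)"
  \<comment> \<open>By Cramer's rule the replacement multiplies the determinant by the entry
    \<open>k\<close> of \<open>s\<close>.\<close>
  have det_B: "det B = det A / (real CARD('n) + 1)"
    unfolding B_def cramer_lemma by (simp add: s_def)
  have "A *v s = column k B"
    by (simp add: B_def column_def vec_eq_iff)
  then have s: "A *v s \<in> lattice_of B"
    by (simp add: lattice_of_column)
  have axis: "A *v axis j 1 \<in> lattice_of B" if "j \<noteq> k" for j
  proof -
    have "A *v axis j 1 = column j B"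
      using that by (simp add: B_def column_def vec_eq_iff matrix_vector_mult_basis)
    then show ?thesis
      by (simp add: lattice_of_column)
  qed
  \<comment> \<open>The all-ones vector is \<open>n + 1\<close> times \<open>s\<close>, which
    recovers the image of the replaced basis vector from the lattice.\<close>
  have "axis k 1 = (real CARD('n) + 1) *\<^sub>R s - (\<Sum>j\<in>- {k}. axis j 1)"
    by (auto simp: vec_eq_iff s_def axis_def)
  then have "A *v axis k 1 = of_int (int CARD('n) + 1) *\<^sub>R (A *v s) - (\<Sum>j\<in>- {k}. A *v axis j 1)"
    by (simp add: matrix_vector_mult_diff_distrib matrix_vector_mult_scaleR
        linear_sum[OF matrix_vector_mul_linear])
  then have "A *v axis k 1 \<in> lattice_of B"
    by (simp only:) (intro lattice_of_diff lattice_of_scale lattice_of_sum s axis, simp)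
  with axis have vertex: "A *v e \<in> lattice_of B" if "e \<in> insert 0 Basis" for e
    using that by (auto simp: Basis_vec_def lattice_of_0) metis
  show thesis
  proof
    have "det P \<noteq> 0"
      using assms by (simp add: invertible_det_nz)
    then show "invertible B"
      unfolding invertible_det_nz det_B det_A by simp
    show "\<bar>det B\<bar> = 2 ^ CARD('n) * \<bar>det P\<bar> / (real CARD('n) + 1)"
      by (simp add: det_B det_A abs_mult)
    show "2 *\<^sub>R (P *v (e - s)) \<in> lattice_of B" if "e \<in> insert 0 Basis" for e
      using lattice_of_diff[OF vertex[OF that] s]
      by (simp add: A matrix_vector_mult_diff_distrib scaleR_diff_right)
  qed
qed

text \<open>On the simplex a linear form takes every value between its extremes at the vertices.
  Steps of positive length at most this width move that interval over the whole real line.\<close>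

lemma impassable_if_centroid_lattice:
  fixes P B :: "real^'n^'n"
  defines "s \<equiv> \<chi> i. 1 / (real CARD('n) + 1)"
  assumes "invertible P"
    and vertex: "\<And>e. e \<in> insert 0 Basis \<Longrightarrow> 2 *\<^sub>R (P *v (e - s)) \<in> lattice_of B"
  shows "impassable (CARD('n) - 1) ((\<lambda>x. p + P *v x) ` (convex hull (insert 0 Basis))) (lattice_of B)"
  unfolding impassable_def
proof (intro allI impI)
  fix H :: "(real^'n) set"
  assume "affine H \<and> aff_dim H = int (CARD('n) - 1)"
  then have "affine hull H = H" "aff_dim H = int (DIM(real^'n) - 1)"
    by (simp_all add: hull_same)
  then obtain a b where "a \<noteq> 0" and H: "H = {x. a \<bullet> x = b}"
    unfolding aff_dim_eq_hyperplane by metis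
  define q where "q = a v* P"
  have q: "a \<bullet> (P *v t) = q \<bullet> t" for t
    by (simp add: q_def dot_lmul_matrix)
  have "q \<noteq> 0"
  proof
    assume "q = 0"
    moreover obtain P' where "P ** P' = mat 1"
      using \<open>invertible P\<close> by (auto simp: invertible_def)
    then have "a = q v* P'"
      by (simp add: q_def vector_matrix_mul_assoc)
    ultimately show False
      using \<open>a \<noteq> 0\<close> by simp
  qed
  let ?V = "insert 0 Basis :: (real^'n) set"
  obtain u where u: "u \<in> ?V" "\<And>e. e \<in> ?V \<Longrightarrow> q \<bullet> e \<le> q \<bullet> u"
    using Max_in[of "(\<bullet>) q ` ?V"] Max_ge[of "(\<bullet>) q ` ?V"] by force
  obtain l where l: "l \<in> ?V" "\<And>e. e \<in> ?V \<Longrightarrow> q \<bullet> l \<le> q \<bullet> e"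
    using Min_in[of "(\<bullet>) q ` ?V"] Min_le[of "(\<bullet>) q ` ?V"] by force
  have "q \<bullet> l < q \<bullet> u"
  proof (rule ccontr)
    assume "\<not> ?thesis"
    then have "q \<bullet> e = 0" if "e \<in> ?V" for e
      using u(2)[OF that] l(2)[OF that] u(2)[of 0] l(2)[of 0] by simp
    then show False
      using \<open>q \<noteq> 0\<close> euclidean_all_zero_iff by blast
  qed
  define N where "N = real CARD('n) + 1"
  have "N > 0"
    by (simp add: N_def add_pos_nonneg)
  have card_V: "real (card ?V) = N"
    by (simp add: N_def)
  have "(\<Sum>Basis :: real^'n) $ i = 1" for i
    using inner_sum_left_Basis[of "axis i 1 :: real^'n" "\<lambda>_. 1"]
    by (simp add: inner_axis axis_in_Basis_iff)
  then have "N *\<^sub>R s = \<Sum>?V"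
    using \<open>N > 0\<close> by (simp add: vec_eq_iff s_def N_def flip: sum_component)
  then have mean: "N * (q \<bullet> s) = (\<Sum>e\<in>?V. q \<bullet> e)"
    by (simp add: inner_sum_right flip: inner_scaleR_right)
  \<comment> \<open>The width is itself a summand of each sum of non-negative terms; hence the value
    at the centroid lies strictly between the extremes.\<close>
  have "q \<bullet> u - q \<bullet> l \<le> (\<Sum>e\<in>?V. q \<bullet> u - q \<bullet> e)" "q \<bullet> u - q \<bullet> l \<le> (\<Sum>e\<in>?V. q \<bullet> e - q \<bullet> l)"
    using u l by (intro member_le_sum[of _ ?V "\<lambda>e. q \<bullet> u - q \<bullet> e"] member_le_sum[of _ ?V "\<lambda>e. q \<bullet> e - q \<bullet> l"]; simp)+
  then have "0 < N * (q \<bullet> u - q \<bullet> s)" "0 < N * (q \<bullet> s - q \<bullet> l)"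
    using \<open>q \<bullet> l < q \<bullet> u\<close>
    by (simp_all only: right_diff_distrib mean sum_subtractf sum_constant card_V)
  then have between: "q \<bullet> s < q \<bullet> u" "q \<bullet> l < q \<bullet> s"
    using \<open>N > 0\<close> by (simp_all add: zero_less_mult_iff)
  \<comment> \<open>The extreme vertex whose value is nearer to that at \<open>s\<close> is chosen,
    so doubling its distance stays within the width. For \<open>l\<close> the sign is reversed to
    make the value positive.\<close>
  obtain v where v: "v \<in> lattice_of B" "0 < a \<bullet> v" "a \<bullet> v \<le> q \<bullet> u - q \<bullet> l"
  proof (cases "q \<bullet> u - q \<bullet> s \<le> q \<bullet> s - q \<bullet> l")
    case True
    show thesis
      by (rule that[OF vertex[OF u(1)]]) (use True between in \<open>simp_all add: q inner_diff_right\<close>)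
  next
    case False
    have "0 - 2 *\<^sub>R (P *v (l - s)) \<in> lattice_of B"
      by (intro lattice_of_diff lattice_of_0 vertex l)
    then show thesis
      by (rule that) (use False between in \<open>simp_all add: q inner_diff_right\<close>)
  qed
  \<comment> \<open>After \<open>k\<close> steps the remaining level \<open>r\<close>, relative to
    \<open>p\<close>, exceeds the minimum by less than one step; \<open>t\<close> below is the point
    on the segment from \<open>l\<close> to \<open>u\<close> at this level.\<close>
  define k where "k = \<lfloor>(b - a \<bullet> p - q \<bullet> l) / (a \<bullet> v)\<rfloor>"
  define r where "r = b - a \<bullet> p - k * (a \<bullet> v)"
  have r: "q \<bullet> l \<le> r" "r \<le> q \<bullet> u"
    using floor_divide_lower[OF v(2), of "b - a \<bullet> p - q \<bullet> l"]
      floor_divide_upper[OF v(2), of "b - a \<bullet> p - q \<bullet> l"] v(3)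
    by (simp_all add: r_def k_def algebra_simps)
  define c where "c = (r - q \<bullet> l) / (q \<bullet> u - q \<bullet> l)"
  define t where "t = (1 - c) *\<^sub>R l + c *\<^sub>R u"
  have c: "0 \<le> c" "c \<le> 1" "c * (q \<bullet> u - q \<bullet> l) = r - q \<bullet> l"
    using r \<open>q \<bullet> l < q \<bullet> u\<close> by (simp_all add: c_def)
  have "t \<in> convex hull ?V"
    unfolding t_def using c u(1) l(1)
    by (intro convexD[OF convex_convex_hull] hull_inc) simp_all
  moreover have "q \<bullet> t = r"
    using c(3) by (simp add: t_def inner_add_right algebra_simps)
  then have "p + P *v t + of_int k *\<^sub>R v \<in> H"
    by (simp add: H inner_add_right q r_def)
  moreover have "of_int k *\<^sub>R v \<in> lattice_of B"
    using v(1) by (rule lattice_of_scale)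
  ultimately show "\<exists>x\<in>lattice_of B.
      H \<inter> (\<lambda>y. y + x) ` ((\<lambda>x. p + P *v x) ` (convex hull ?V)) \<noteq> {}"
    by blast
qed

section \<open>Lower bound and exact density\<close>

text \<open>A non-zero dual lattice vector that is a difference of points of the projected cube
  would be a direction in which the simplex is narrower than 1. The packing bound then compares the
  volume of the projected cube with the determinant of the dual lattice.\<close>

lemma abs_det_ratio_ge_if_impassable:
  fixes A P :: "real^'n^'n"
  assumes "invertible A" "invertible P"
    and imp: "impassable (CARD('n) - 1) ((\<lambda>x. p + P *v x) ` (convex hull (insert 0 Basis))) (lattice_of A)"
  shows "(real CARD('n) + 1) / 2 ^ CARD('n) \<le> \<bar>det P\<bar> / \<bar>det A\<bar>"
proof -
  obtain B where BA: "B ** A = mat 1"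
    using assms(1) by (auto simp: invertible_def)
  have "det B * det A = 1"
    using arg_cong[OF BA, of det] by (simp add: det_mul)
  then have det_B: "det B = 1 / det A"
    by (metis nonzero_eq_divide_eq mult_zero_right zero_neq_one)
  \<comment> \<open>The dual lattice in the coordinates of the standard simplex consists of the
    vectors \<open>z v* (B ** P)\<close> with integral \<open>z\<close>; the transpose turns rows
    into the generating columns of \<open>lattice_of\<close>.\<close>
  let ?C = "transpose (B ** P)"
  have "det A \<noteq> 0" "det P \<noteq> 0"
    using assms by (simp_all add: invertible_det_nz)
  then have "invertible ?C"
    by (simp add: invertible_det_nz det_mul det_B)
  obtain S :: "(real^'n) set" where S: "S \<in> lmeasurable"
    "measure lebesgue S = (real CARD('n) + 1) / 2 ^ CARD('n)"
    "\<And>x y. x \<in> S \<Longrightarrow> y \<in> S \<Longrightarrow> \<exists>c. \<bar>c\<bar> < 1/2 \<and> (\<forall>i. \<bar>x $ i - y $ i - c\<bar> < 1/2)"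
    using projected_cube_measure by blast
  have "measure lebesgue S \<le> \<bar>det ?C\<bar>"
  proof (rule measure_le_abs_det_if_no_lattice_difference[OF S(1) \<open>invertible ?C\<close>])
    fix x y assume xy: "x \<in> S" "y \<in> S" "x - y \<in> lattice_of ?C"
    then obtain z where z: "x - y = z v* (B ** P)" "\<And>i. z $ i \<in> \<int>"
      by (auto simp: lattice_of_def)
    obtain c where c: "\<bar>c\<bar> < 1/2" "\<And>i. \<bar>(z v* (B ** P)) $ i - c\<bar> < 1/2"
      using S(3)[OF xy(1,2)] by (auto simp flip: z(1))
    then have "z = 0"
      using impassable_simplex_dual_not_narrow[OF BA imp z(2) _ c(1)] by (meson not_le)
    then show "x = y"
      using z(1) by simp
  qed
  then show ?thesis
    by (simp add: S(2) det_mul det_B abs_mult)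
qed

theorem proposition3p1:
  fixes K :: "(real^'n) set"
  assumes "CARD('n) \<ge> 2"
    and "int CARD('n) simplex K"
  shows "min_density (CARD('n) - 1) K = (real CARD('n) + 1) / (2 ^ CARD('n) * fact CARD('n)) \<and>
    (\<exists>r \<in> o(\<lambda>n. real n). \<forall>n\<ge>2.
       (real n + 1) / (2 ^ n * fact n) = real n powr (- real n) * (exp 1 / 2) ^ n * exp (r n))"
proof (rule conjI[OF _ density_asymptotics])
  let ?d = "(real CARD('n) + 1) / (2 ^ CARD('n) * fact CARD('n))"
  obtain p and P :: "real^'n^'n" where P: "invertible P"
    "K = (\<lambda>x. p + P *v x) ` (convex hull (insert 0 Basis))"
    using simplex_eq_affine_image_std_simplex[OF assms(2)] by blast
  have density: "translates_density K (lattice_of A) = \<bar>det P\<bar> / \<bar>det A\<bar> / fact CARD('n)"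
    if "invertible A" for A
    using that by (simp add: translates_density_def lattice_det_lattice_of P(2)
        measure_affine_image_std_simplex)
  obtain B where B: "invertible B" "\<bar>det B\<bar> = 2 ^ CARD('n) * \<bar>det P\<bar> / (real CARD('n) + 1)"
    "\<And>e. e \<in> insert 0 Basis \<Longrightarrow>
      2 *\<^sub>R (P *v (e - (\<chi> i. 1 / (real CARD('n) + 1)))) \<in> lattice_of B"
    using lattice_around_centroid[OF P(1)] by blast
  show "min_density (CARD('n) - 1) K = ?d"
    unfolding min_density_def
  \<comment> \<open>The infimum is attained at \<open>lattice_of B\<close>, where
    \<open>det P\<close> cancels from the density.\<close>
  proof (rule cInf_eq_minimum)
    have "impassable (CARD('n) - 1) K (lattice_of B)"
      unfolding P(2) by (rule impassable_if_centroid_lattice[OF P(1) B(3)])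
    moreover have "det P \<noteq> 0"
      using P(1) by (simp add: invertible_det_nz)
    then have "translates_density K (lattice_of B) = ?d"
      by (simp add: density[OF B(1)] B(2))
    ultimately show "?d \<in> {translates_density K L | L. is_lattice L \<and> impassable (CARD('n) - 1) K L}"
      using B(1) unfolding is_lattice_def by force
  next
    fix d assume "d \<in> {translates_density K L | L. is_lattice L \<and> impassable (CARD('n) - 1) K L}"
    then obtain A where A: "invertible A" "impassable (CARD('n) - 1) K (lattice_of A)"
      "d = translates_density K (lattice_of A)"
      by (auto simp: is_lattice_def)
    have "(real CARD('n) + 1) / 2 ^ CARD('n) \<le> \<bar>det P\<bar> / \<bar>det A\<bar>"
      using A(2) unfolding P(2) by (rule abs_det_ratio_ge_if_impassable[OF A(1) P(1)])
    then have "(real CARD('n) + 1) / 2 ^ CARD('n) / fact CARD('n) \<le> \<bar>det P\<bar> / \<bar>det A\<bar> / fact CARD('n)"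
      by (rule divide_right_mono) simp
    then show "?d \<le> d"
      by (simp add: A(3) density[OF A(1)])
  qed
qed

end
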